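(* There exist a connected complete metric space $X$ and a continuous function $f:X\to\mathbb{R}$ which is locally extremal but not constant.
   Context: A function $f:X\to\mathbb{R}$ on a topological space $X$ is locally extremal if each point $x\in X$ is a point of local minimum or of local maximum of $f$; that is, for each $x\in X$ there is a neighborhood $O$ of $x$ in $X$ such that either $f(x)\le f(y)$ for all $y\in O$, or $f(x)\ge f(y)$ for all $y\in O$. *)

theory Defs
  imports "HOL-Analysis.Analysis"
begin

definition locally_extremal :: "'a topology \<Rightarrow> ('a \<Rightarrow> real) \<Rightarrow> bool" where
  "locally_extremal X f \<longleftrightarrow>
     (\<forall>x\<in>topspace X. \<exists>U. openin X U \<and> x \<in> U \<and>
        ((\<forall>y\<in>U. f x \<le> f y) \<or> (\<forall>y\<in>U. f x \<ge> f y)))"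

(* HOL cannot quantify existentially over types, so an existence claim about metric spaces has
   to name a type for the points. This type has the cardinality of the power set of the
   continuum; the space itself may live on any subset of it. *)
type_synonym point = "(nat \<Rightarrow> real) \<Rightarrow> real"

end

theory Submission
  imports Defs
begin

text \<open>
  For every real \<open>s\<close> take a hedgehog with unit spines, one spine for each index \<open>u = (t, b)\<close> with
  \<open>t\<close> real and \<open>b\<close> Boolean, and let the function be constantly \<open>s\<close> on it. For every index \<open>(t, b)\<close>
  the tips of the corresponding spines are glued into a second hedgehog whose centre is the tip in
  the fibre of \<open>t\<close>: only tips of fibres to the right of \<open>t\<close> (if \<open>b\<close>) or to the left of \<open>t\<close>
  (otherwise) approach this centre, so the function has a one-sided extremum there and is locally
  constant at all other points. The fibres are connected, so a clopen set is a union of fibres;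
  the corresponding set of reals contains a right and a left neighbourhood of each of its points,
  as does its complement, hence it is trivial.
\<close>

section \<open>The glued hedgehogs and their metric\<close>

text \<open>Length of the spine over \<open>s\<close> in the second hedgehog of index
  \<open>u\<close>. The value \<open>1\<close> on the wrong side keeps those tips away from its
  centre, the tip with \<open>s = fst u\<close>.\<close>

definition tip_dist :: "real \<times> bool \<Rightarrow> real \<Rightarrow> real" where
  "tip_dist u s = (if (if snd u then fst u \<le> s else s \<le> fst u) then \<bar>s - fst u\<bar> else 1)"

text \<open>The centre of the fibre over \<open>s\<close> has \<open>r = 0\<close>; its index is normalised to an arbitrary value
  because all spines meet there.\<close>

definition web :: "(real \<times> (real \<times> bool) \<times> real) set" where
  "web = {(s, u, r). 0 \<le> r \<and> r \<le> 1 \<and> (r = 0 \<longrightarrow> u = (0, True))}"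

text \<open>Truncation at \<open>1\<close> makes the triangle inequality local: a path that uses both a change of
  spine and a change of fibre traverses a whole spine.\<close>

definition web_dist ::
    "real \<times> (real \<times> bool) \<times> real \<Rightarrow> real \<times> (real \<times> bool) \<times> real \<Rightarrow> real" where
  "web_dist = (\<lambda>(s, u, r) (s', u', r').
     if s = s' then if u = u' then \<bar>r - r'\<bar> else min 1 (\<bar>r\<bar> + \<bar>r'\<bar>)
     else if u = u' then min 1 (\<bar>1 - r\<bar> + tip_dist u s + (\<bar>1 - r'\<bar> + tip_dist u s')) else 1)"

lemma in_web_iff: "(s, u, r) \<in> web \<longleftrightarrow> 0 \<le> r \<and> r \<le> 1 \<and> (r = 0 \<longrightarrow> u = (0, True))"
  by (simp add: web_def)

lemma web_dist_simp:
  "web_dist (s, u, r) (s', u', r') =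
     (if s = s' then if u = u' then \<bar>r - r'\<bar> else min 1 (\<bar>r\<bar> + \<bar>r'\<bar>)
      else if u = u' then min 1 (\<bar>1 - r\<bar> + tip_dist u s + (\<bar>1 - r'\<bar> + tip_dist u s')) else 1)"
  by (simp add: web_dist_def)

lemma tip_dist_nonneg: "0 \<le> tip_dist u s"
  by (simp add: tip_dist_def)

lemma tip_dist_eq_0_iff: "tip_dist u s = 0 \<longleftrightarrow> s = fst u"
  by (auto simp: tip_dist_def)

interpretation web: Metric_space web web_dist
proof
  fix x y z :: "real \<times> (real \<times> bool) \<times> real"
  obtain s u r where x: "x = (s, u, r)" by (metis surj_pair)
  obtain s' u' r' where y: "y = (s', u', r')" by (metis surj_pair)
  obtain s'' u'' r'' where z: "z = (s'', u'', r'')" by (metis surj_pair)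
  have nn: "0 \<le> tip_dist v a" for v a by (rule tip_dist_nonneg)
  show "0 \<le> web_dist x y"
    using nn by (simp add: x y web_dist_simp)
  show "web_dist x y = web_dist y x"
    by (auto simp: x y web_dist_simp abs_minus_commute add.commute)
  show "web_dist x y = 0 \<longleftrightarrow> x = y" if X: "x \<in> web" and Y: "y \<in> web"
  proof
    \<comment> \<open>On different spines of one fibre both radii vanish, and there the index is
      normalised. Different fibres cannot occur: both would lie over \<open>fst u\<close>.\<close>
    show "x = y" if "web_dist x y = 0"
      using that X Y nn[of u s] nn[of u s'] tip_dist_eq_0_iff[of u s] tip_dist_eq_0_iff[of u s']
      unfolding x y in_web_iff web_dist_simp by (auto split: if_splits simp: min_def)
  qed (auto simp: x y web_dist_simp)
  show "web_dist x z \<le> web_dist x y + web_dist y z"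
    if X: "x \<in> web" and Y: "y \<in> web" and Z: "z \<in> web"
  proof -
    have r: "0 \<le> r" "r \<le> 1" "0 \<le> r'" "r' \<le> 1" "0 \<le> r''" "r'' \<le> 1"
      using X Y Z by (auto simp: x y z in_web_iff)
    have le1: "web_dist x z \<le> 1"
      using r by (auto simp: x z web_dist_simp)
    have xy0: "0 \<le> web_dist x y" and yz0: "0 \<le> web_dist y z"
      using nn by (simp_all add: x y z web_dist_simp)
    \<comment> \<open>In cases 3 and 4 the change of spine costs at least \<open>r'\<close> and the
      change of fibre at least \<open>1 - r'\<close>, so the right-hand side reaches the maximal
      distance \<open>1\<close>.\<close>
    consider "s = s'" "s' = s''" | "u = u'" "u' = u''"
      | "s = s'" "s' \<noteq> s''" "u \<noteq> u'" | "s \<noteq> s'" "s' = s''" "u' \<noteq> u''"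
      | "s \<noteq> s'" "u \<noteq> u'" | "s' \<noteq> s''" "u' \<noteq> u''"
      by blast
    then show ?thesis
    proof cases
      case 1
      with r show ?thesis
        by (simp add: x y z web_dist_simp min_def) linarith
    next
      case 2
      with r nn[of u s] nn[of u s'] nn[of u s''] show ?thesis
        by (simp add: x y z web_dist_simp min_def) linarith
    next
      case 3
      with r nn[of u' s'] nn[of u' s''] have "1 \<le> web_dist x y + web_dist y z"
        by (cases "u' = u''") (auto simp: x y z web_dist_simp min_def)
      with le1 show ?thesis by simp
    next
      case 4
      with r nn[of u s] nn[of u s'] have "1 \<le> web_dist x y + web_dist y z"
        by (cases "u = u'") (auto simp: x y z web_dist_simp min_def)
      with le1 show ?thesis by simp
    next
      case 5
      then have "web_dist x y = 1"
        by (simp add: x y web_dist_simp)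
      with le1 yz0 show ?thesis by simp
    next
      case 6
      then have "web_dist y z = 1"
        by (simp add: y z web_dist_simp)
      with le1 xy0 show ?thesis by simp
    qed
  qed
qed

section \<open>Completeness\<close>

text \<open>A Cauchy sequence eventually keeps its fibre or its index. If the other coordinate
  stabilises too, the sequence converges along a spine; otherwise it converges to the centre of a
  hedgehog of one of the two kinds.\<close>

lemma web_mcomplete: "web.mcomplete"
  unfolding web.mcomplete_def
proof (intro allI impI)
  fix \<sigma> assume \<sigma>: "web.MCauchy \<sigma>"
  define S U R where "S n = fst (\<sigma> n)" and "U n = fst (snd (\<sigma> n))" and "R n = snd (snd (\<sigma> n))"
    for n
  have \<sigma>_eq: "\<sigma> n = (S n, U n, R n)" for n
    by (simp add: S_def U_def R_def)
  have \<sigma>_web: "\<sigma> n \<in> web" for n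
    using \<sigma> unfolding web.MCauchy_def by auto
  have R: "0 \<le> R n" "R n \<le> 1" for n
    using \<sigma>_web[of n] by (auto simp: \<sigma>_eq in_web_iff)
  have nn: "0 \<le> tip_dist v a" for v a by (rule tip_dist_nonneg)
  have cauchy: "\<exists>N. \<forall>m\<ge>N. \<forall>n\<ge>N. web_dist (\<sigma> m) (\<sigma> n) < \<epsilon>" if "\<epsilon> > 0" for \<epsilon>
    using \<sigma> that unfolding web.MCauchy_def by meson
  obtain N where N: "web_dist (\<sigma> m) (\<sigma> n) < 1/3" if "m \<ge> N" "n \<ge> N" for m n
    using cauchy[of "1/3"] by (meson zero_less_divide_1_iff zero_less_numeral)
  \<comment> \<open>For \<open>\<epsilon> < 1\<close> the truncation at \<open>1\<close> drops out
    of the estimates.\<close>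
  have lim: "\<exists>x. limitin web.mtopology \<sigma> x sequentially"
    if "x \<in> web" and close: "\<And>\<epsilon>. 0 < \<epsilon> \<Longrightarrow> \<epsilon> < 1 \<Longrightarrow> \<exists>K. \<forall>n\<ge>K. web_dist (\<sigma> n) x < \<epsilon>" for x
  proof -
    have "\<exists>K. \<forall>n\<ge>K. web_dist (\<sigma> n) x < \<epsilon>" if "\<epsilon> > 0" for \<epsilon>
    proof -
      have "0 < min \<epsilon> (1/2)" "min \<epsilon> (1/2) < 1"
        using that by auto
      from close[OF this] show ?thesis by auto
    qed
    then show ?thesis
      using \<open>x \<in> web\<close> \<sigma>_web by (intro exI[of _ x]) (simp add: web.limit_metric_sequentially)
  qed
  have same: "U m = U n \<or> S m = S n" if "m \<ge> N" "n \<ge> N" for m n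
    using N[OF that] by (auto simp: \<sigma>_eq web_dist_simp split: if_splits)
  have inner: "R m < 1/3" if "m \<ge> N" "n \<ge> N" "U m \<noteq> U n" for m n
    using N[OF that(1,2)] same[OF that(1,2)] R[of m] R[of n] that(3)
    by (simp add: \<sigma>_eq web_dist_simp min_def split: if_splits)
  have outer: "R m > 2/3" if "m \<ge> N" "n \<ge> N" "S m \<noteq> S n" for m n
    using N[OF that(1,2)] same[OF that(1,2)] R[of m] R[of n] that(3)
      nn[of "U n" "S m"] nn[of "U n" "S n"]
    by (simp add: \<sigma>_eq web_dist_simp min_def split: if_splits)
  \<comment> \<open>Otherwise the radius of the term at \<open>N\<close> would be below
    \<open>1/3\<close> because of a later change of index and above \<open>2/3\<close> because of a
    later change of fibre.\<close>
  have US: "(\<exists>u. \<forall>m\<ge>N. U m = u) \<or> (\<exists>s. \<forall>m\<ge>N. S m = s)"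
  proof (rule ccontr)
    assume "\<not> ?thesis"
    then obtain m n where mn: "m \<ge> N" "U N \<noteq> U m" "n \<ge> N" "S N \<noteq> S n"
      by metis
    show False
      using inner[OF order_refl mn(1,2)] outer[OF order_refl mn(3,4)] by simp
  qed
  consider (const) K u s where "\<forall>m\<ge>K. U m = u" "\<forall>m\<ge>K. S m = s"
    | (tips) u where "\<forall>m\<ge>N. U m = u" "\<forall>K\<ge>N. \<exists>m\<ge>K. S m \<noteq> S K"
    | (centre) s where "\<forall>m\<ge>N. S m = s" "\<forall>K\<ge>N. \<exists>m\<ge>K. U m \<noteq> U K"
    using US
  proof (elim disjE exE)
    fix u assume u: "\<forall>m\<ge>N. U m = u"
    show thesis
    proof (cases "\<forall>K\<ge>N. \<exists>m\<ge>K. S m \<noteq> S K")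
      case True
      with u show thesis by (rule tips)
    next
      case False
      then obtain K where "K \<ge> N" "\<forall>m\<ge>K. S m = S K" by blast
      with u show thesis by (intro const[of K u "S K"]) (blast intro: order_trans)+
    qed
  next
    fix s assume s: "\<forall>m\<ge>N. S m = s"
    show thesis
    proof (cases "\<forall>K\<ge>N. \<exists>m\<ge>K. U m \<noteq> U K")
      case True
      with s show thesis by (rule centre)
    next
      case False
      then obtain K where "K \<ge> N" "\<forall>m\<ge>K. U m = U K" by blast
      with s show thesis by (intro const[of K "U K" s]) (blast intro: order_trans)+
    qed
  qed
  then show "\<exists>x. limitin web.mtopology \<sigma> x sequentially"
  proof cases
    case const
    have d: "web_dist (\<sigma> m) (\<sigma> n) = \<bar>R m - R n\<bar>" if "m \<ge> K" "n \<ge> K" for m n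
      using const that by (simp add: \<sigma>_eq web_dist_simp)
    have "Cauchy R"
    proof (rule metric_CauchyI)
      fix \<epsilon> :: real assume "\<epsilon> > 0"
      then obtain L where "\<forall>m\<ge>L. \<forall>n\<ge>L. web_dist (\<sigma> m) (\<sigma> n) < \<epsilon>"
        using cauchy by blast
      then show "\<exists>M. \<forall>m\<ge>M. \<forall>n\<ge>M. dist (R m) (R n) < \<epsilon>"
        using d by (intro exI[of _ "max K L"]) (metis dist_real_def max.bounded_iff)
    qed
    then obtain r where r: "R \<longlonglongrightarrow> r"
      using Cauchy_convergent convergent_def by blast
    have r01: "0 \<le> r" "r \<le> 1"
      using r R by (auto intro: LIMSEQ_le_const LIMSEQ_le_const2)
    show ?thesis
    \<comment> \<open>If the radii tend to \<open>0\<close>, the limit is the fibre centre, which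
      carries the normalised index.\<close>
    proof (rule lim[of "(s, if r = 0 then (0, True) else u, r)"])
      fix \<epsilon> :: real assume "\<epsilon> > 0" "\<epsilon> < 1"
      then obtain L where "\<forall>n\<ge>L. \<bar>R n - r\<bar> < \<epsilon>"
        using r unfolding LIMSEQ_iff by auto
      then show "\<exists>L. \<forall>n\<ge>L. web_dist (\<sigma> n) (s, if r = 0 then (0, True) else u, r) < \<epsilon>"
        using const \<open>\<epsilon> < 1\<close>
        by (intro exI[of _ "max K L"]) (auto simp: \<sigma>_eq web_dist_simp min_less_iff_disj)
    qed (use r01 in \<open>auto simp: in_web_iff\<close>)
  next
    case tips
    show ?thesis
    proof (rule lim[of "(fst u, u, 1)"])
      fix \<epsilon> :: real assume "\<epsilon> > 0" "\<epsilon> < 1"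
      then obtain L where L: "\<forall>m\<ge>L. \<forall>n\<ge>L. web_dist (\<sigma> m) (\<sigma> n) < \<epsilon>"
        using cauchy by blast
      have "web_dist (\<sigma> n) (fst u, u, 1) < \<epsilon>" if n: "n \<ge> max N L" for n
      proof -
        \<comment> \<open>Between different fibres, a distance below \<open>1\<close> is the sum of
          the two distances to the glued centre \<open>(fst u, u, 1)\<close>, so it bounds each of
          them.\<close>
        obtain m where m: "m \<ge> n" "S m \<noteq> S n"
          using tips(2) n by auto
        have U: "U m = u" "U n = u"
          using tips(1) m n by auto
        have "web_dist (\<sigma> m) (\<sigma> n) < \<epsilon>"
          using L m n by simp
        then have "1 - R n + tip_dist u (S n) < \<epsilon>"
          using m U R[of n] R[of m] nn[of u "S m"] \<open>\<epsilon> < 1\<close>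
          by (simp add: \<sigma>_eq web_dist_simp min_less_iff_disj)
        then show ?thesis
          using U R[of n] nn[of u "S n"] tip_dist_eq_0_iff[of u "fst u"]
          by (auto simp: \<sigma>_eq web_dist_simp min_less_iff_disj)
      qed
      then show "\<exists>L. \<forall>n\<ge>L. web_dist (\<sigma> n) (fst u, u, 1) < \<epsilon>" by blast
    qed (simp add: in_web_iff)
  next
    case centre
    show ?thesis
    proof (rule lim[of "(s, (0, True), 0)"])
      fix \<epsilon> :: real assume "\<epsilon> > 0" "\<epsilon> < 1"
      then obtain L where L: "\<forall>m\<ge>L. \<forall>n\<ge>L. web_dist (\<sigma> m) (\<sigma> n) < \<epsilon>"
        using cauchy by blast
      have "web_dist (\<sigma> n) (s, (0, True), 0) < \<epsilon>" if n: "n \<ge> max N L" for n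
      proof -
        \<comment> \<open>Likewise, between different spines of one fibre a distance below
          \<open>1\<close> is the sum of the distances to the fibre centre.\<close>
        obtain m where m: "m \<ge> n" "U m \<noteq> U n"
          using centre(2) n by auto
        have S: "S m = s" "S n = s"
          using centre(1) m n by auto
        have "web_dist (\<sigma> m) (\<sigma> n) < \<epsilon>"
          using L m n by simp
        then have "R n < \<epsilon>"
          using m S R[of n] R[of m] \<open>\<epsilon> < 1\<close>
          by (simp add: \<sigma>_eq web_dist_simp min_less_iff_disj)
        then show ?thesis
          using S R[of n] by (auto simp: \<sigma>_eq web_dist_simp min_less_iff_disj)
      qed
      then show "\<exists>L. \<forall>n\<ge>L. web_dist (\<sigma> n) (s, (0, True), 0) < \<epsilon>" by blast
    qed (simp add: in_web_iff)
  qed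
qed

section \<open>The fibre coordinate: continuity and local extremality\<close>

text \<open>At distance below \<open>1\<close>, a change of fibre from \<open>s\<close> to
  \<open>s'\<close> costs at least \<open>\<bar>s - fst u\<bar> + \<bar>s' - fst u\<bar>\<close>,
  hence at least \<open>\<bar>s - s'\<bar>\<close>.\<close>

lemma continuous_map_fst_web: "continuous_map web.mtopology euclideanreal fst"
proof -
  have "\<exists>\<delta>>0. \<forall>y. y \<in> web \<and> web_dist x y < \<delta> \<longrightarrow> dist (fst x) (fst y) < \<epsilon>"
    if x: "x \<in> web" and \<epsilon>: "\<epsilon> > 0" for x \<epsilon>
  proof (intro exI conjI allI impI)
    fix y assume y: "y \<in> web \<and> web_dist x y < min 1 \<epsilon>"
    obtain s u r where x_eq: "x = (s, u, r)" by (metis surj_pair)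
    obtain s' u' r' where y_eq: "y = (s', u', r')" by (metis surj_pair)
    show "dist (fst x) (fst y) < \<epsilon>"
      using x y \<epsilon>
      by (auto simp: x_eq y_eq in_web_iff web_dist_simp tip_dist_def dist_real_def split: if_splits)
  qed (use \<epsilon> in auto)
  then show ?thesis
    using web.metric_continuous_map[OF Met_TC.Metric_space_axioms, of fst] by simp
qed

lemma locally_extremal_fst_web: "locally_extremal web.mtopology fst"
  unfolding locally_extremal_def
proof (intro ballI)
  fix x assume "x \<in> topspace web.mtopology"
  then have x: "x \<in> web" by simp
  obtain s t b r where x_eq: "x = (s, (t, b), r)" by (metis surj_pair)
  \<comment> \<open>\<open>w\<close> is the cost of reaching the glued centre of index
    \<open>(t, b)\<close>. If it is positive, a ball of radius \<open>min 1 w\<close> cannot leave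
    the fibre; if it is \<open>0\<close>, the point is this centre and the unit ball meets only
    fibres on the side chosen by \<open>b\<close>.\<close>
  define w where "w = 1 - r + tip_dist (t, b) s"
  have r: "0 \<le> r" "r \<le> 1"
    using x by (auto simp: x_eq in_web_iff)
  have nn: "0 \<le> tip_dist v a" for v a by (rule tip_dist_nonneg)
  define \<epsilon> where "\<epsilon> = (if w = 0 then 1 else min 1 w)"
  have "w \<ge> 0" using r nn[of "(t, b)" s] by (simp add: w_def)
  then have "\<epsilon> > 0" by (simp add: \<epsilon>_def)
  have "(\<forall>y\<in>web.mball x \<epsilon>. s \<le> fst y) \<or> (\<forall>y\<in>web.mball x \<epsilon>. s \<ge> fst y)"
  proof (cases "w = 0")
    case True
    then have "s = t"
      using r nn[of "(t, b)" s] tip_dist_eq_0_iff[of "(t, b)" s] by (simp add: w_def)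
    then show ?thesis
      using True
      by (cases b) (fastforce simp: x_eq \<epsilon>_def web_dist_simp tip_dist_def split: if_splits)+
  next
    case False
    have "fst y = s" if y: "y \<in> web.mball x \<epsilon>" for y
    proof -
      obtain s' u' r' where y_eq: "y = (s', u', r')" by (metis surj_pair)
      show ?thesis
        using y False nn[of "(t, b)" s'] r
        by (auto simp: x_eq y_eq \<epsilon>_def w_def web_dist_simp split: if_splits)
    qed
    then show ?thesis by simp
  qed
  then show "\<exists>U. openin web.mtopology U \<and> x \<in> U \<and>
      ((\<forall>y\<in>U. fst x \<le> fst y) \<or> (\<forall>y\<in>U. fst x \<ge> fst y))"
    using x \<open>\<epsilon> > 0\<close> by (intro exI[of _ "web.mball x \<epsilon>"]) (simp add: x_eq)
qed

section \<open>Connectedness\<close>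

text \<open>A spine is a path through the point and the centre of its fibre, and a clopen set cannot
  split it.\<close>

lemma clopen_web_fibre:
  assumes V: "openin web.mtopology V" "closedin web.mtopology V" and x: "(s, u, r) \<in> web"
  shows "(s, u, r) \<in> V \<longleftrightarrow> (s, (0, True), 0) \<in> V"
proof -
  define g where "g a = (s, if a = 0 then (0, True) else u, a)" for a :: real
  have "\<exists>T. openin (top_of_set {0..1}) T \<and> a \<in> T \<and> (\<forall>c\<in>T. g c \<in> web.mball (g a) \<epsilon>)"
    if "a \<in> {0..1}" "\<epsilon> > 0" for a \<epsilon>
    using that
    by (intro exI[of _ "{0..1} \<inter> ball a \<epsilon>"])
       (auto simp: g_def in_web_iff web_dist_simp dist_real_def openin_open_Int)
  then have "continuous_map (top_of_set {0..1}) web.mtopology g"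
    by (simp add: web.continuous_map_to_metric)
  then have "connectedin web.mtopology (g ` {0..1})"
    by (rule connectedin_continuous_map_image) (simp add: connectedin_subtopology)
  then have "g ` {0..1} \<subseteq> V \<or> disjnt (g ` {0..1}) V"
    using V connectedin_clopen_cases by blast
  moreover have "g 0 = (s, (0, True), 0)" "g r = (s, u, r)" "r \<in> {0..1}"
    using x by (auto simp: g_def in_web_iff)
  ultimately show ?thesis
    by (metis atLeastAtMost_iff disjnt_iff image_eqI order_refl subset_iff zero_le_one)
qed

text \<open>With the centre over \<open>t\<close>, \<open>V\<close> contains the tips of the spines
  \<open>(t, True)\<close> and \<open>(t, False)\<close>. Openness at these two glued centres
  captures nearby tips to the right and to the left of \<open>t\<close>, and hence the centres of
  their fibres.\<close>

lemma clopen_web_open_projection: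
  assumes V: "openin web.mtopology V" "closedin web.mtopology V"
  shows "open {s. (s, (0, True), 0) \<in> V}"
  unfolding open_dist
proof (intro ballI, simp)
  fix t assume t: "(t, (0, True), 0) \<in> V"
  have tip: "(s, u, 1) \<in> web" for s u by (simp add: in_web_iff)
  have side: "\<exists>\<epsilon>>0. \<forall>s. tip_dist (t, b) s < \<epsilon> \<longrightarrow> (s, (0, True), 0) \<in> V" for b
  proof -
    have "(t, (t, b), 1) \<in> V"
      using t clopen_web_fibre[OF V tip] by simp
    then obtain \<epsilon> where "\<epsilon> > 0" and \<epsilon>: "web.mball (t, (t, b), 1) \<epsilon> \<subseteq> V"
      using V(1) unfolding web.openin_mtopology by blast
    have "(s, (0, True), 0) \<in> V" if "tip_dist (t, b) s < \<epsilon>" for s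
    proof -
      have "(s, (t, b), 1) \<in> web.mball (t, (t, b), 1) \<epsilon>"
        using that \<open>\<epsilon> > 0\<close> tip_dist_eq_0_iff[of "(t, b)" t]
        by (simp add: tip web_dist_simp min_less_iff_disj)
      then show ?thesis
        using \<epsilon> clopen_web_fibre[OF V tip] by blast
    qed
    with \<open>\<epsilon> > 0\<close> show ?thesis by blast
  qed
  obtain \<delta> \<epsilon> where "\<delta> > 0" and right: "\<forall>s. tip_dist (t, True) s < \<delta> \<longrightarrow> (s, (0, True), 0) \<in> V"
    and "\<epsilon> > 0" and left: "\<forall>s. tip_dist (t, False) s < \<epsilon> \<longrightarrow> (s, (0, True), 0) \<in> V"
    using side by metis
  have "(s, (0, True), 0) \<in> V" if "dist s t < min \<delta> \<epsilon>" for s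
    using that right[rule_format, of s] left[rule_format, of s]
    by (cases "t \<le> s") (auto simp: tip_dist_def dist_real_def)
  with \<open>\<delta> > 0\<close> \<open>\<epsilon> > 0\<close> show "\<exists>e>0. \<forall>s. dist s t < e \<longrightarrow> (s, (0, True), 0) \<in> V"
    by (intro exI[of _ "min \<delta> \<epsilon>"]) auto
qed

lemma connected_space_web: "connected_space web.mtopology"
  unfolding connected_space_clopen_in
proof (intro allI impI)
  fix V assume V: "openin web.mtopology V \<and> closedin web.mtopology V"
  define P where "P = {s. (s, (0, True), 0) \<in> V}"
  have "open P"
    using V clopen_web_open_projection by (simp add: P_def)
  \<comment> \<open>The complement of \<open>V\<close> is clopen as well, and its fibre centres are
    those over \<open>- P\<close>.\<close>
  moreover have "- P = {s. (s, (0, True), 0) \<in> web - V}"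
    by (auto simp: P_def in_web_iff)
  then have "open (- P)"
    using V clopen_web_open_projection[of "web - V"]
    by (metis openin_diff closedin_diff openin_topspace closedin_topspace web.topspace_mtopology)
  ultimately have "P = {} \<or> P = UNIV"
    by (simp add: clopen[symmetric] closed_def)
  moreover have "V \<subseteq> web"
    using V openin_subset by fastforce
  ultimately show "V = {} \<or> V = topspace web.mtopology"
    using V clopen_web_fibre[of V] unfolding P_def by (auto 4 4)
qed

section \<open>Transport to the prescribed type of points\<close>

text \<open>This moves a space along an injection into another type, here \<open>point\<close>, with
  image \<open>range j\<close>.\<close>

lemma homeomorphic_maps_pullback_inv:
  assumes "inj j"
  shows "homeomorphic_maps T (pullback_topology (range j) (inv j) T) j (inv j)"
proof -
  have "inv j \<circ> j = id" using assms by simp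
  moreover have "continuous_map (pullback_topology (range j) (inv j) T) T (id \<circ> inv j)"
    by (rule continuous_map_pullback) simp
  moreover have "continuous_map T (pullback_topology (range j) (inv j) T) j"
    using assms by (intro continuous_map_pullback') auto
  ultimately show ?thesis
    using assms by (auto simp: homeomorphic_maps_def topspace_pullback_topology)
qed

lemma ex_inj_point: "\<exists>j :: real \<times> (real \<times> bool) \<times> real \<Rightarrow> point. inj j"
proof
  \<comment> \<open>The coordinates are stored as the values at the constant functions
    \<open>0\<close>, \<open>1\<close>, \<open>2\<close> and \<open>3\<close>; the last falls under
    the final \<open>else\<close> and encodes the Boolean.\<close>
  define j :: "real \<times> (real \<times> bool) \<times> real \<Rightarrow> point" where
    "j = (\<lambda>(s, (t, b), r) h. if h 0 = 0 then s else if h 0 = 1 then t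
            else if h 0 = 2 then r else of_bool b)"
  have "(fst x, (fst (fst (snd x)), snd (fst (snd x))), snd (snd x)) =
    (j x (\<lambda>_. 0), (j x (\<lambda>_. 1), j x (\<lambda>_. 3) = 1), j x (\<lambda>_. 2))" for x
    by (auto simp: j_def split: prod.splits)
  then show "inj j"
    by (intro injI) (metis prod.collapse)
qed

theorem theorem2:
  "\<exists>(X :: point metric) (f :: point \<Rightarrow> real).
     connected_space (mtopology_of X) \<and>
     mcomplete_of X \<and>
     continuous_map (mtopology_of X) euclideanreal f \<and>
     locally_extremal (mtopology_of X) f \<and>
     \<not> f constant_on mspace X"
proof -
  obtain j :: "real \<times> (real \<times> bool) \<times> real \<Rightarrow> point" where "inj j"
    using ex_inj_point by blast
  define T where "T = pullback_topology (range j) (inv j) web.mtopology"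
  have hom: "homeomorphic_maps web.mtopology T j (inv j)"
    unfolding T_def using \<open>inj j\<close> by (rule homeomorphic_maps_pullback_inv)
  then have inv: "continuous_map T web.mtopology (inv j)"
    and hs: "web.mtopology homeomorphic_space T"
    by (auto simp: homeomorphic_maps_def homeomorphic_space_def)
  \<comment> \<open>The metric need not be transported by hand: complete metrizability is a
    homeomorphism invariant and supplies some complete metric inducing \<open>T\<close>.\<close>
  have "completely_metrizable_space T"
    using hs web_mcomplete web.completely_metrizable_space_mtopology
      homeomorphic_completely_metrizable_space by blast
  then obtain M d where Md: "Metric_space M d" "Metric_space.mcomplete M d"
    "T = Metric_space.mtopology M d"
    unfolding completely_metrizable_space_def by blast
  define X where "X = metric (M, d)"
  have T: "mtopology_of X = T" "mcomplete_of X" "mspace X = topspace T"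
    using Md by (simp_all add: X_def Metric_space.mtopology_of Metric_space.mcomplete_of
        Metric_space.mspace_metric Metric_space.topspace_mtopology)
  have "locally_extremal T (fst \<circ> inv j)"
    unfolding locally_extremal_def
  proof
    fix x assume x: "x \<in> topspace T"
    then have "inv j x \<in> topspace web.mtopology"
      using inv by (auto simp: continuous_map_def)
    then obtain U where U: "openin web.mtopology U" "inv j x \<in> U"
      "(\<forall>y\<in>U. fst (inv j x) \<le> fst y) \<or> (\<forall>y\<in>U. fst (inv j x) \<ge> fst y)"
      using locally_extremal_fst_web unfolding locally_extremal_def by blast
    then show "\<exists>U. openin T U \<and> x \<in> U \<and> ((\<forall>y\<in>U. (fst \<circ> inv j) x \<le> (fst \<circ> inv j) y) \<or>
        (\<forall>y\<in>U. (fst \<circ> inv j) x \<ge> (fst \<circ> inv j) y))"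
      using x openin_continuous_map_preimage[OF inv U(1)]
      by (intro exI[of _ "{x \<in> topspace T. inv j x \<in> U}"]) auto
  qed
  moreover have "connected_space T"
    using hs connected_space_web homeomorphic_connected_space by blast
  moreover have "continuous_map T euclideanreal (fst \<circ> inv j)"
    using inv continuous_map_fst_web by (rule continuous_map_compose)
  moreover have "\<not> (fst \<circ> inv j) constant_on topspace T"
  proof
    assume "(fst \<circ> inv j) constant_on topspace T"
    \<comment> \<open>The images of the fibre centres over \<open>0\<close> and \<open>1\<close>
      give two different values.\<close>
    moreover have "j (s, (0, True), 0) \<in> topspace T" for s
      using \<open>inj j\<close> by (simp add: T_def topspace_pullback_topology in_web_iff)
    ultimately have "(0 :: real) = 1"
      using \<open>inj j\<close> unfolding constant_on_def by (metis comp_apply fst_conv inv_f_f)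
    then show False by simp
  qed
  ultimately show ?thesis
    using T by (intro exI[of _ X] exI[of _ "fst \<circ> inv j"]) simp
qed

end
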